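(* Let $A\in\mathbb{R}^{n\times n}$ be symmetric positive definite, $b\in\mathbb{R}^n$, $f(x)=\tfrac12x^TAx-x^Tb$. Fix $\ell\in\{0,\tfrac12,1,\tfrac32,2,\tfrac52,3,\dots\}$, $\omega\in(0,2)$ and $x_0\in\mathbb{R}^n$. Consider the following scheme, which stores the $\lfloor\ell\rfloor+2$ vectors $v_k^{(0)},\dots,v_k^{(\lfloor\ell\rfloor+1)}$. Initialize $$v_0^{(0)}=Ax_0-b,\qquad v_0^{(j)}=A\,v_0^{(j-1)}\quad (j=1,\dots,\lfloor\ell\rfloor+1),$$ and for $k\ge0$ compute $$\alpha_k=\frac{\bigl(v_k^{(\lfloor\ell\rfloor)}\bigr)^T v_k^{(\lfloor\ell+\frac12\rfloor)}}{\bigl(v_k^{(\lfloor\ell+\frac12\rfloor)}\bigr)^T v_k^{(\lfloor\ell+1\rfloor)}},\qquad x_{k+1}=x_k-\omega\alpha_k v_k^{(0)},$$ $$v_{k+1}^{(j)}=v_k^{(j)}-\omega\alpha_k v_k^{(j+1)}\quad(j=0,\dots,\lfloor\ell\rfloor),\qquad v_{k+1}^{(\lfloor\ell\rfloor+1)}=A\,v_{k+1}^{(\lfloor\ell\rfloor)}.$$ Then, in exact arithmetic, the sequence $(x_k)_{k\ge0}$ produced by this scheme is exactly the sequence of iterates of the Relaxed $\ell$-Minimal Gradient Descent method with relaxation parameter $\omega$ started at $x_0$: for all $k\ge0$, with $g_k=Ax_k-b$, one has $v_k^{(j)}=A^jg_k$ for $j=0,\dots,\lfloor\ell\rfloor+1$,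 and the scalar $\alpha_k$ above equals the step size $\dfrac{y_k^Ty_k}{y_k^TAy_k}$ with $y_k=A^{\ell}g_k$. Consequently, after an initial overhead of $\lfloor\ell\rfloor+2$ matrix-vector products with $A$ (one for $Ax_0$ and $\lfloor\ell\rfloor+1$ for $v_0^{(1)},\dots,v_0^{(\lfloor\ell\rfloor+1)}$) and with storage for $\lfloor\ell\rfloor+2$ additional vectors, every Relaxed $\ell$-Minimal Gradient Descent method can be implemented using exactly one matrix-vector product per iteration.
   Context: Half-integer powers of $A$ are defined through its unique positive definite square root $A^{1/2}$, and $A^0=I$. Relaxed $\ell$-Minimal Gradient Descent method (with relaxation parameter $\omega$): from $x_0\in\mathbb{R}^n$, for $k\ge 0$ set $g_k=\nabla f(x_k)=Ax_k-b$, $y_k=A^{\ell}g_k$, $\alpha_k=\dfrac{y_k^Ty_k}{y_k^TAy_k}$, and $x_{k+1}=x_k-\omega\alpha_k g_k$. If $g_k=0$, the step is taken to be zero, i.e. $\alpha_k:=0$ and $x_{k+1}=x_k$; the same convention ($\alpha_k:=0$ when $v_k^{(0)}=0$) is used in the scheme of the claim. *)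

theory Defs
  imports "HOL-Analysis.Analysis"
begin

definition sym_pos_def :: "real^'n^'n \<Rightarrow> bool" where
  "sym_pos_def A \<longleftrightarrow> transpose A = A \<and> (\<forall>x. x \<noteq> 0 \<longrightarrow> x \<bullet> (A *v x) > 0)"

primrec mat_power :: "real^'n^'n \<Rightarrow> nat \<Rightarrow> real^'n^'n" where
  "mat_power A 0 = mat 1"
| "mat_power A (Suc j) = A ** mat_power A j"

definition mat_sqrt :: "real^'n^'n \<Rightarrow> real^'n^'n" where
  "mat_sqrt A = (THE B. sym_pos_def B \<and> B ** B = A)"

text \<open>Only meant for \<open>l\<close> in \<open>{0, 1/2, 1, 3/2, ...}\<close>.\<close>

definition mat_half_power :: "real^'n^'n \<Rightarrow> real \<Rightarrow> real^'n^'n" where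
  "mat_half_power A l =
     (if l \<in> \<int> then mat_power A (nat \<lfloor>l\<rfloor>) else mat_power (mat_sqrt A) (nat \<lfloor>2 * l\<rfloor>))"

definition quad_obj :: "real^'n^'n \<Rightarrow> real^'n \<Rightarrow> real^'n \<Rightarrow> real" where
  "quad_obj A b x = 1/2 * (x \<bullet> (A *v x)) - x \<bullet> b"

definition gradient :: "('a::real_inner \<Rightarrow> real) \<Rightarrow> 'a \<Rightarrow> 'a" where
  "gradient f x = (THE D. GDERIV f x :> D)"

definition mgd_step_size :: "real^'n^'n \<Rightarrow> real^'n \<Rightarrow> real \<Rightarrow> real^'n \<Rightarrow> real" where
  "mgd_step_size A b l x =
     (let g = gradient (quad_obj A b) x;
          y = mat_half_power A l *v g
      in if g = 0 then 0 else (y \<bullet> y) / (y \<bullet> (A *v y)))"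

primrec rlmgd :: "real^'n^'n \<Rightarrow> real^'n \<Rightarrow> real \<Rightarrow> real \<Rightarrow> real^'n \<Rightarrow> nat \<Rightarrow> real^'n" where
  "rlmgd A b l \<omega> x0 0 = x0"
| "rlmgd A b l \<omega> x0 (Suc k) =
     rlmgd A b l \<omega> x0 k
     - (\<omega> * mgd_step_size A b l (rlmgd A b l \<omega> x0 k))
         *\<^sub>R gradient (quad_obj A b) (rlmgd A b l \<omega> x0 k)"

text \<open>
  The number of matrix-vector products and the vector storage are properties of an
  implementation, not of the function it computes, so implementations are deeply embedded.
  The matrix is accessible only through the instruction \<open>MatVec\<close>.  The registers
  \<open>XReg\<close> and \<open>BReg\<close> hold the iterate and the right-hand side; the
  registers \<open>VReg j\<close> are additional storage.
\<close>

datatype vreg = XReg | BReg | VReg nat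

datatype instr =
    MatVec vreg vreg
  | Axpy vreg nat vreg
  | Dot nat vreg vreg
  | SConst nat real
  | SScale nat real nat
  | SDiv nat nat nat

type_synonym 'n memory = "(vreg \<Rightarrow> real^'n) \<times> (nat \<Rightarrow> real)"

text \<open>
  The zero test in \<open>SDiv\<close> implements the convention that the step size is zero
  when the gradient vanishes; for a positive definite matrix the denominator of the step size
  vanishes in no other case.
\<close>

fun exec :: "real^'n^'n \<Rightarrow> instr \<Rightarrow> 'n memory \<Rightarrow> 'n memory" where
  "exec A (MatVec d s) (V, S) = (V(d := A *v V s), S)"
| "exec A (Axpy d c s) (V, S) = (V(d := V d + S c *\<^sub>R V s), S)"
| "exec A (Dot d s t) (V, S) = (V, S(d := V s \<bullet> V t))"
| "exec A (SConst d r) (V, S) = (V, S(d := r))"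
| "exec A (SScale d r c) (V, S) = (V, S(d := r * S c))"
| "exec A (SDiv d p q) (V, S) = (V, S(d := (if S q = 0 then 0 else S p / S q)))"

definition run :: "real^'n^'n \<Rightarrow> instr list \<Rightarrow> 'n memory \<Rightarrow> 'n memory" where
  "run A p M = fold (exec A) p M"

fun is_matvec :: "instr \<Rightarrow> bool" where
  "is_matvec (MatVec d s) = True"
| "is_matvec _ = False"

definition matvec_count :: "instr list \<Rightarrow> nat" where
  "matvec_count p = length (filter is_matvec p)"

fun instr_vregs :: "instr \<Rightarrow> vreg set" where
  "instr_vregs (MatVec d s) = {d, s}"
| "instr_vregs (Axpy d c s) = {d, s}"
| "instr_vregs (Dot d s t) = {s, t}"
| "instr_vregs _ = {}"

definition vregs :: "instr list \<Rightarrow> vreg set" where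
  "vregs p = (\<Union>i\<in>set p. instr_vregs i)"

definition residual_prog :: "instr list" where
  "residual_prog = [MatVec (VReg 0) XReg, SConst 0 (-1), Axpy (VReg 0) 0 BReg]"

definition krylov_prog :: "real \<Rightarrow> instr list" where
  "krylov_prog l = map (\<lambda>j. MatVec (VReg (Suc j)) (VReg j)) [0..<nat \<lfloor>l\<rfloor> + 1]"

definition init_prog :: "real \<Rightarrow> instr list" where
  "init_prog l = residual_prog @ krylov_prog l"

text \<open>
  Scalar register 2 receives the step size and scalar register 3 receives \<open>- \<omega>\<close>
  times the step size.  The vectors are overwritten in increasing order of the index, so each
  update still reads the old value of its successor.
\<close>

definition iter_prog :: "real \<Rightarrow> real \<Rightarrow> instr list" where
  "iter_prog l \<omega> =
     [Dot 0 (VReg (nat \<lfloor>l\<rfloor>)) (VReg (nat \<lfloor>l + 1/2\<rfloor>)),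
      Dot 1 (VReg (nat \<lfloor>l + 1/2\<rfloor>)) (VReg (nat \<lfloor>l + 1\<rfloor>)),
      SDiv 2 0 1,
      SScale 3 (- \<omega>) 2,
      Axpy XReg 3 (VReg 0)]
     @ map (\<lambda>j. Axpy (VReg j) 3 (VReg (Suc j))) [0..<nat \<lfloor>l\<rfloor> + 1]
     @ [MatVec (VReg (nat \<lfloor>l\<rfloor> + 1)) (VReg (nat \<lfloor>l\<rfloor>))]"

definition full_prog :: "real \<Rightarrow> real \<Rightarrow> nat \<Rightarrow> instr list" where
  "full_prog l \<omega> k = init_prog l @ concat (replicate k (iter_prog l \<omega>))"

end

theory Submission
  imports Defs
begin

text \<open>
  The invariant \<open>v\<^sub>k\<^sup>(\<^sup>j\<^sup>) = A\<^sup>j g\<^sub>k\<close> survives a step because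
  \<open>g\<^bsub>k+1\<^esub> = g\<^sub>k - \<omega> \<alpha>\<^sub>k A g\<^sub>k\<close> and \<open>A\<^sup>j\<close> is linear.  Self-adjointness lets the
  powers of \<open>A\<close> in \<open>y\<^sup>T y = g\<^sup>T A\<^sup>m g\<close> and \<open>y\<^sup>T A y = g\<^sup>T A\<^bsup>m+1\<^esup> g\<close>, where \<open>m = 2 l\<close>, be
  distributed over the two factors as integer powers.
  The square root of \<open>A\<close> is obtained without the spectral theorem: for small \<open>t > 0\<close> the
  operator \<open>X = I - t A\<close> has norm below 1, so \<open>Y \<mapsto> (X + Y\<^sup>2) / 2\<close> has a symmetric fixed
  point \<open>Y\<close> of norm below 1, and \<open>(I - Y) / \<surd>t\<close> is the root.
\<close>

section \<open>Square roots of positive definite matrices\<close>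

lemma symmetric_matrix_iff:
  fixes A :: "real^'n^'n"
  shows "transpose A = A \<longleftrightarrow> (\<forall>x y. (A *v x) \<bullet> y = x \<bullet> (A *v y))"
proof
  assume "transpose A = A"
  then show "\<forall>x y. (A *v x) \<bullet> y = x \<bullet> (A *v y)"
    by (metis dot_lmul_matrix vector_transpose_matrix)
next
  assume *: "\<forall>x y. (A *v x) \<bullet> y = x \<bullet> (A *v y)"
  have "(transpose A *v x) \<bullet> y = (A *v x) \<bullet> y" for x y
    using * by (metis dot_lmul_matrix vector_transpose_matrix transpose_transpose)
  then show "transpose A = A"
    unfolding matrix_eq by (metis inner_commute vector_eq_rdot)
qed

text \<open>Prepares the uniqueness proof: for symmetric \<open>D\<close> it makes the trace of
  \<open>D ** (M ** D)\<close> a sum of values of the quadratic form of \<open>M\<close> at the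
  columns of \<open>D\<close>.\<close>

lemma trace_eq_sum_inner:
  fixes M :: "real^'n^'n"
  shows "trace M = (\<Sum>i\<in>UNIV. axis i 1 \<bullet> (M *v axis i 1))"
  by (simp add: trace_def inner_axis' matrix_vector_mult_basis column_def)

lemma sym_pos_def_inner_pos: "sym_pos_def A \<Longrightarrow> x \<noteq> 0 \<Longrightarrow> x \<bullet> (A *v x) > 0"
  by (simp add: sym_pos_def_def)

lemma sym_pos_def_inner_commute: "sym_pos_def A \<Longrightarrow> (A *v x) \<bullet> y = x \<bullet> (A *v y)"
  by (simp add: sym_pos_def_def symmetric_matrix_iff)

lemma sym_pos_def_mult_eq_0: "sym_pos_def A \<Longrightarrow> A *v x = 0 \<longleftrightarrow> x = 0"
  using sym_pos_def_inner_pos[of A x] by (cases "x = 0") auto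

text \<open>The quadratic form attains its minimum \<open>m\<close> on the compact unit sphere,
  where it is positive; homogeneity of degree two carries the bound to all \<open>x\<close>.\<close>

lemma sym_pos_def_coercive:
  fixes A :: "real^'n^'n"
  assumes "sym_pos_def A"
  obtains m where "m > 0" "\<And>x. m * (norm x)\<^sup>2 \<le> x \<bullet> (A *v x)"
proof -
  obtain i :: 'n where True by simp
  have "axis i 1 \<in> sphere (0 :: real^'n) 1" by (simp add: norm_axis_1)
  then have "sphere (0 :: real^'n) 1 \<noteq> {}" by blast
  moreover have "continuous_on (sphere 0 1) (\<lambda>x. x \<bullet> (A *v x))"
    by (intro continuous_intros linear_continuous_on_compose matrix_vector_mul_linear)
  ultimately obtain u where u: "u \<in> sphere 0 1" "\<And>x. x \<in> sphere 0 1 \<Longrightarrow> u \<bullet> (A *v u) \<le> x \<bullet> (A *v x)"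
    using continuous_attains_inf[OF compact_sphere] by blast
  have "u \<noteq> 0" using u(1) by auto
  then have "u \<bullet> (A *v u) > 0" using assms by (rule sym_pos_def_inner_pos[rotated])
  moreover have "(u \<bullet> (A *v u)) * (norm x)\<^sup>2 \<le> x \<bullet> (A *v x)" for x
  proof (cases "x = 0")
    case False
    have "u \<bullet> (A *v u) \<le> ((1 / norm x) *\<^sub>R x) \<bullet> (A *v ((1 / norm x) *\<^sub>R x))"
      using False by (intro u(2)) simp
    also have "\<dots> = (x \<bullet> (A *v x)) / (norm x)\<^sup>2"
      by (simp add: matrix_vector_mult_scaleR power2_eq_square)
    finally show ?thesis using False by (simp add: field_simps)
  qed simp
  ultimately show thesis by (rule that)
qed

text \<open>Expanding the square bounds the squared norm by \<open>1 - 2 * t * m + t^2 * M^2\<close>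
  times that of \<open>x\<close>, where \<open>m\<close> is the coercivity constant and
  \<open>M\<close> a bound on the norm of \<open>A\<close>.\<close>

lemma sym_pos_def_contraction:
  fixes A :: "real^'n^'n"
  assumes spd: "sym_pos_def A"
  obtains t q where "t > 0" "0 \<le> q" "q < 1" "\<And>x. norm (x - t *\<^sub>R (A *v x)) \<le> q * norm x"
proof -
  obtain m where m: "m > 0" "\<And>x. m * (norm x)\<^sup>2 \<le> x \<bullet> (A *v x)"
    using sym_pos_def_coercive[OF spd] by blast
  obtain N where N: "N > 0" "\<And>x. norm (A *v x) \<le> norm x * N"
    using bounded_linear.pos_bounded[OF matrix_vector_mul_bounded_linear[of A]] by blast
  \<comment> \<open>Enlarging the norm bound by \<open>m\<close> forces \<open>m < M\<close>, so
    that \<open>s\<close> below lies strictly between 0 and 1.\<close>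
  define M where "M = N + m"
  have M: "M > 0" "m < M" using m(1) N(1) by (auto simp: M_def)
  have bound: "norm (A *v x) \<le> M * norm x" for x
  proof -
    have "norm (A *v x) \<le> N * norm x" using N(2)[of x] by (simp add: mult.commute)
    also have "\<dots> \<le> M * norm x" using m(1) by (intro mult_right_mono) (auto simp: M_def)
    finally show ?thesis .
  qed
  \<comment> \<open>The minimizer of \<open>1 - 2 * t * m + t^2 * M^2\<close>; the minimum is
    \<open>1 - s\<close>.\<close>
  define t where "t = m / M\<^sup>2"
  define s where "s = m\<^sup>2 / M\<^sup>2"
  have s: "0 < s" "s < 1" using m(1) M by (auto simp: s_def power_strict_mono)
  have t: "t > 0" using m(1) M by (simp add: t_def)
  \<comment> \<open>The factor \<open>1 - s / 2\<close> replaces the square root of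
    \<open>1 - s\<close>, since \<open>(1 - s / 2)^2\<close> exceeds \<open>1 - s\<close> by
    \<open>s^2 / 4\<close>.\<close>
  have "norm (x - t *\<^sub>R (A *v x)) \<le> (1 - s / 2) * norm x" for x
  proof (rule power2_le_imp_le)
    have tm: "t * m = s" "t\<^sup>2 * M\<^sup>2 = s" using M by (auto simp: t_def s_def field_simps power2_eq_square)
    have "(norm (x - t *\<^sub>R (A *v x)))\<^sup>2 = (norm x)\<^sup>2 - 2 * t * (x \<bullet> (A *v x)) + t\<^sup>2 * (norm (A *v x))\<^sup>2"
      unfolding power2_norm_eq_inner
      by (simp add: inner_diff_left inner_diff_right inner_commute algebra_simps power2_eq_square)
    also have "\<dots> \<le> (norm x)\<^sup>2 - 2 * t * (m * (norm x)\<^sup>2) + t\<^sup>2 * (M * norm x)\<^sup>2"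
      using m(2)[of x] bound[of x] t
      by (intro add_mono diff_mono mult_left_mono power_mono) auto
    also have "\<dots> = (norm x)\<^sup>2 - 2 * (t * m) * (norm x)\<^sup>2 + (t\<^sup>2 * M\<^sup>2) * (norm x)\<^sup>2"
      by (simp add: power_mult_distrib)
    also have "\<dots> = (1 - s) * (norm x)\<^sup>2" unfolding tm by (simp add: algebra_simps)
    also have "\<dots> \<le> (1 - s / 2)\<^sup>2 * (norm x)\<^sup>2"
      by (intro mult_right_mono) (auto simp: power2_eq_square algebra_simps)
    finally show "(norm (x - t *\<^sub>R (A *v x)))\<^sup>2 \<le> ((1 - s / 2) * norm x)\<^sup>2"
      by (simp add: power_mult_distrib)
  qed (use s in auto)
  with t s show thesis by (intro that[of t "1 - s / 2"]) auto
qed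

text \<open>Banach's theorem on the self-adjoint operators in a closed ball of radius below 1. The
  fixed point equation is a disguised square root: it says \<open>(I - Y)^2 = I - X\<close>.\<close>

lemma sqrt_fixed_point:
  fixes X :: "'a::euclidean_space \<Rightarrow>\<^sub>L 'a"
  assumes X: "norm X < 1" and sym: "\<And>x y. X x \<bullet> y = x \<bullet> X y"
  obtains Y :: "'a \<Rightarrow>\<^sub>L 'a"
    where "norm Y < 1" "\<And>x y. Y x \<bullet> y = x \<bullet> Y y" "Y = (1/2) *\<^sub>R (X + (Y o\<^sub>L Y))"
proof -
  \<comment> \<open>The midpoint of \<open>norm X\<close> and 1: large enough for
    \<open>norm X + r * r \<le> 2 * r\<close>, which keeps the ball invariant, and below 1, so that
    it also serves as contraction constant.\<close>
  define r where "r = (1 + norm X) / 2"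
  have r: "0 \<le> r" "r < 1" using X by (auto simp: r_def)
  define T where "T Y = (1/2) *\<^sub>R (X + (Y o\<^sub>L Y))" for Y :: "'a \<Rightarrow>\<^sub>L 'a"
  define K where "K = cball (0 :: 'a \<Rightarrow>\<^sub>L 'a) r \<inter> {Y :: 'a \<Rightarrow>\<^sub>L 'a. \<forall>x y. Y x \<bullet> y = x \<bullet> Y y}"
  have "closed {Y :: 'a \<Rightarrow>\<^sub>L 'a. \<forall>x y. Y x \<bullet> y = x \<bullet> Y y}"
    by (intro closed_Collect_all closed_Collect_eq continuous_intros)
  then have "complete K" unfolding K_def complete_eq_closed by (intro closed_Int) auto
  moreover have "0 \<in> K" using r by (simp add: K_def)
  then have "K \<noteq> {}" by blast
  moreover have "T ` K \<subseteq> K"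
  proof
    fix Z assume "Z \<in> T ` K"
    then obtain Y :: "'a \<Rightarrow>\<^sub>L 'a" where Y: "Z = T Y" "norm Y \<le> r" "\<And>x y. Y x \<bullet> y = x \<bullet> Y y"
      by (auto simp: K_def)
    have "norm (X + (Y o\<^sub>L Y)) \<le> norm X + norm Y * norm Y"
      using norm_triangle_ineq norm_blinfun_compose by (meson add_left_mono order_trans)
    also have "\<dots> \<le> norm X + r * r" using Y(2) by (intro add_left_mono mult_mono) (auto simp: r)
    also have "\<dots> \<le> 2 * r"
    proof -
      have "norm X * norm X \<le> 1" using X mult_mono[of "norm X" 1 "norm X" 1] by simp
      then show ?thesis using X by (simp add: r_def field_simps)
    qed
    finally have "norm Z \<le> r" by (simp add: Y(1) T_def)
    moreover have "Z x \<bullet> y = x \<bullet> Z y" for x y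
      by (simp add: Y(1,3) T_def sym blinfun.bilinear_simps inner_add_left inner_add_right)
    ultimately show "Z \<in> K" by (simp add: K_def)
  qed
  moreover have "\<forall>Y\<in>K. \<forall>Z\<in>K. dist (T Y) (T Z) \<le> r * dist Y Z"
  proof (intro ballI)
    fix Y Z assume "Y \<in> K" "Z \<in> K"
    then have YZ: "norm Y \<le> r" "norm Z \<le> r" by (auto simp: K_def)
    \<comment> \<open>Difference of squares for operators that may not commute:
      \<open>Y Y - Z Z = Y (Y - Z) + (Y - Z) Z\<close>.\<close>
    have "T Y - T Z = (1/2) *\<^sub>R ((Y o\<^sub>L (Y - Z)) + ((Y - Z) o\<^sub>L Z))"
      by (intro blinfun_eqI) (simp add: T_def blinfun.bilinear_simps scaleR_add_right algebra_simps)
    then have "norm (T Y - T Z) \<le> (norm (Y o\<^sub>L (Y - Z)) + norm ((Y - Z) o\<^sub>L Z)) / 2"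
      using norm_triangle_ineq[of "Y o\<^sub>L (Y - Z)" "(Y - Z) o\<^sub>L Z"] by simp
    also have "\<dots> \<le> (norm Y * norm (Y - Z) + norm (Y - Z) * norm Z) / 2"
      using norm_blinfun_compose by (intro divide_right_mono add_mono) auto
    also have "\<dots> \<le> (r * norm (Y - Z) + norm (Y - Z) * r) / 2"
      using YZ by (intro divide_right_mono add_mono mult_mono) (auto simp: r)
    finally show "dist (T Y) (T Z) \<le> r * dist Y Z" by (simp add: dist_norm mult.commute)
  qed
  ultimately obtain Y where "Y \<in> K" "T Y = Y"
    using Banach_fix[of K r T] r by blast
  then show thesis using r by (intro that[of Y]) (auto simp: K_def T_def)
qed

text \<open>With \<open>X = I - t A\<close> the fixed point satisfies
  \<open>(I - Y)^2 = t A\<close>, hence the scaling by \<open>c = 1 / sqrt t\<close>. Positivity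
  comes from \<open>norm Y < 1\<close>: the form \<open>x \<bullet> Y x\<close> stays strictly below
  \<open>x \<bullet> x\<close> for nonzero \<open>x\<close>.\<close>

lemma sym_pos_def_sqrt_exists:
  fixes A :: "real^'n^'n"
  assumes spd: "sym_pos_def A"
  obtains B where "sym_pos_def B" "B ** B = A"
proof -
  obtain t q where t: "t > 0" and q: "0 \<le> q" "q < 1"
    and contr: "\<And>x. norm (x - t *\<^sub>R (A *v x)) \<le> q * norm x"
    using sym_pos_def_contraction[OF spd] by blast
  define X where "X = Blinfun (\<lambda>x. x - t *\<^sub>R (A *v x))"
  have X: "blinfun_apply X x = x - t *\<^sub>R (A *v x)" for x
    unfolding X_def by (subst bounded_linear_Blinfun_apply) (auto intro!: bounded_linear_intros)
  have "norm X \<le> q" using q(1) by (rule norm_blinfun_bound) (simp add: X contr)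
  moreover have "X x \<bullet> y = x \<bullet> X y" for x y
    by (simp add: X inner_diff_left inner_diff_right sym_pos_def_inner_commute[OF spd])
  ultimately obtain Y :: "(real^'n) \<Rightarrow>\<^sub>L (real^'n)" where Y: "norm Y < 1" "\<And>x y. Y x \<bullet> y = x \<bullet> Y y"
      and fp: "Y = (1/2) *\<^sub>R (X + (Y o\<^sub>L Y))"
    using q(2) by (auto intro: sqrt_fixed_point[of X])
  have fp': "Y (Y x) = 2 *\<^sub>R Y x - (x - t *\<^sub>R (A *v x))" for x
  proof -
    have "2 *\<^sub>R Y x = X x + Y (Y x)"
      by (subst fp) (simp add: blinfun.bilinear_simps)
    then show ?thesis by (simp add: X)
  qed
  define c where "c = 1 / sqrt t"
  have c: "c > 0" "c * c * t = 1" using t by (auto simp: c_def)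
  define B where "B = matrix (\<lambda>x. c *\<^sub>R (x - Y x))"
  have B: "B *v x = c *\<^sub>R (x - Y x)" for x
    unfolding B_def
    by (subst matrix_vector_mul)
       (auto intro!: bounded_linear.linear bounded_linear_intros blinfun.bounded_linear_right)
  have "sym_pos_def B"
    unfolding sym_pos_def_def symmetric_matrix_iff
  proof (intro conjI allI impI)
    show "(B *v x) \<bullet> y = x \<bullet> (B *v y)" for x y
      by (simp add: B inner_diff_left inner_diff_right Y(2))
    fix x :: "real^'n" assume "x \<noteq> 0"
    have "x \<bullet> Y x \<le> norm x * norm (Y x)" by (rule norm_cauchy_schwarz)
    also have "\<dots> \<le> norm x * (norm Y * norm x)" by (intro mult_left_mono norm_blinfun) auto
    also have "\<dots> < norm x * (1 * norm x)"
      using Y(1) \<open>x \<noteq> 0\<close> by (intro mult_strict_left_mono mult_strict_right_mono) auto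
    also have "\<dots> = x \<bullet> x" by (simp add: dot_square_norm power2_eq_square)
    finally show "0 < x \<bullet> (B *v x)" using c by (simp add: B inner_diff_right)
  qed
  moreover have "B ** B = A"
    unfolding matrix_eq
  proof
    fix x
    have "(B ** B) *v x = (c * c) *\<^sub>R (x - Y x - (Y x - Y (Y x)))"
      by (simp add: B blinfun.bilinear_simps flip: matrix_vector_mul_assoc)
         (simp add: algebra_simps)
    also have "\<dots> = (c * c * t) *\<^sub>R (A *v x)" by (simp add: fp' algebra_simps flip: scaleR_2)
    finally show "(B ** B) *v x = A *v x" by (simp add: c)
  qed
  ultimately show thesis by (rule that)
qed

text \<open>
  If \<open>B\<^sup>2 = C\<^sup>2\<close> and \<open>D = B - C\<close> then \<open>B D + D C = 0\<close>, so \<open>tr (D B D) + tr (D C D) = 0\<close>,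
  where both traces are sums of nonnegative terms.
\<close>

lemma sym_pos_def_sqrt_unique:
  fixes B C :: "real^'n^'n"
  assumes B: "sym_pos_def B" and C: "sym_pos_def C" and eq: "B ** B = C ** C"
  shows "B = C"
proof -
  define D where "D = B - C"
  have D: "(D *v x) \<bullet> y = x \<bullet> (D *v y)" for x y
    by (simp add: D_def matrix_vector_mult_diff_rdistrib inner_diff_left inner_diff_right
        sym_pos_def_inner_commute[OF B] sym_pos_def_inner_commute[OF C])
  have "B ** D + D ** C = B ** B - C ** C"
    by (simp add: D_def matrix_eq matrix_vector_mult_add_rdistrib matrix_vector_mult_diff_rdistrib
        matrix_vector_mult_diff_distrib flip: matrix_vector_mul_assoc)
  then have "D ** (B ** D + D ** C) = 0" by (simp add: eq)
  then have "trace (D ** (B ** D) + D ** (D ** C)) = 0"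
    by (simp add: matrix_add_ldistrib trace_def)
  then have "trace (D ** (B ** D)) + trace (D ** (D ** C)) = 0"
    by (simp only: trace_add)
  \<comment> \<open>Cyclicity of the trace puts \<open>C\<close> between two copies of
    \<open>D\<close>, so that both traces become sums of quadratic forms at the columns of
    \<open>D\<close>.\<close>
  moreover have "trace (D ** (D ** C)) = trace (D ** (C ** D))"
    by (metis matrix_mul_assoc trace_mul_sym)
  moreover have "trace (D ** (M ** D)) = (\<Sum>i\<in>UNIV. (D *v axis i 1) \<bullet> (M *v (D *v axis i 1)))" for M
    by (simp add: trace_eq_sum_inner D flip: matrix_vector_mul_assoc)
  ultimately have *: "(\<Sum>i\<in>UNIV. (D *v axis i 1) \<bullet> (B *v (D *v axis i 1))
      + (D *v axis i 1) \<bullet> (C *v (D *v axis i 1))) = 0"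
    by (simp add: sum.distrib)
  have pos: "x \<bullet> (B *v x) + x \<bullet> (C *v x) > 0" if "x \<noteq> 0" for x
    using that B C by (intro add_pos_pos sym_pos_def_inner_pos)
  have nonneg: "x \<bullet> (B *v x) + x \<bullet> (C *v x) \<ge> 0" for x
    using pos[of x] by (cases "x = 0") auto
  have "D *v axis i 1 = 0" for i
  proof -
    have "(D *v axis i 1) \<bullet> (B *v (D *v axis i 1)) + (D *v axis i 1) \<bullet> (C *v (D *v axis i 1)) = 0"
      using * nonneg by (subst (asm) sum_nonneg_eq_0_iff) auto
    then show ?thesis using pos by (metis less_irrefl)
  qed
  then have "D = 0" by (simp add: matrix_vector_mult_basis column_def vec_eq_iff)
  then show ?thesis by (simp add: D_def)
qed

text \<open>Existence and uniqueness together make the definite description in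
  \<open>mat_sqrt\<close> meaningful.\<close>

lemma mat_sqrt:
  assumes "sym_pos_def A"
  shows "sym_pos_def (mat_sqrt A)" "mat_sqrt A ** mat_sqrt A = A"
proof -
  have "\<exists>!B. sym_pos_def B \<and> B ** B = A"
    using sym_pos_def_sqrt_exists[OF assms] sym_pos_def_sqrt_unique by (metis (no_types, lifting))
  from theI'[OF this] show "sym_pos_def (mat_sqrt A)" "mat_sqrt A ** mat_sqrt A = A"
    by (auto simp: mat_sqrt_def)
qed

section \<open>Matrix powers and the step size\<close>

lemma mat_power_add: "mat_power A (i + j) = mat_power A i ** mat_power A j"
  by (induction i) (auto simp: matrix_mul_assoc)

lemma mat_power_mult_vec_add: "mat_power A i *v (mat_power A j *v x) = mat_power A (i + j) *v x"
  by (simp add: mat_power_add matrix_vector_mul_assoc)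

lemma mat_power_Suc_mult_vec: "mat_power A (Suc j) *v x = A *v (mat_power A j *v x)"
  by (simp add: matrix_vector_mul_assoc)

lemma mat_power_Suc_mult_vec': "mat_power A (Suc j) *v x = mat_power A j *v (A *v x)"
  using mat_power_mult_vec_add[of A j 1 x] by simp

lemma mat_power_mat_power: "mat_power (mat_power A i) j = mat_power A (i * j)"
  by (induction j) (auto simp: mat_power_add)

text \<open>Self-adjointness moves the factors across one at a time. Only the total exponent
  matters, which is why the scheme may split it differently from
  \<open>y \<bullet> y\<close>.\<close>

lemma mat_power_inner:
  assumes "sym_pos_def A"
  shows "(mat_power A i *v x) \<bullet> (mat_power A j *v y) = x \<bullet> (mat_power A (i + j) *v y)"
proof (induction i arbitrary: j)
  case (Suc i)
  have "(mat_power A (Suc i) *v x) \<bullet> (mat_power A j *v y)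
      = (mat_power A i *v x) \<bullet> (mat_power A (Suc j) *v y)"
    by (simp only: mat_power_Suc_mult_vec sym_pos_def_inner_commute[OF assms])
  then show ?case by (simp only: Suc.IH) simp
qed simp

lemma mat_power_mult_eq_0:
  assumes "sym_pos_def A"
  shows "mat_power A j *v x = 0 \<longleftrightarrow> x = 0"
  by (induction j) (auto simp: sym_pos_def_mult_eq_0[OF assms] simp flip: matrix_vector_mul_assoc)

text \<open>Splitting the exponent in halves leaves \<open>z \<bullet> z\<close> or
  \<open>z \<bullet> (A *v z)\<close> with \<open>z = mat_power A (j div 2) *v x\<close>, which is
  nonzero because \<open>A\<close> is injective.\<close>

lemma mat_power_inner_pos:
  assumes spd: "sym_pos_def A" and "x \<noteq> 0"
  shows "x \<bullet> (mat_power A j *v x) > 0"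
proof -
  define i where "i = j div 2"
  have nz: "mat_power A i *v x \<noteq> 0" using assms by (simp add: mat_power_mult_eq_0)
  consider "j = i + i" | "j = i + Suc i" unfolding i_def by linarith
  then show ?thesis
  proof cases
    case 1
    then show ?thesis using nz by (simp only: 1 mat_power_inner[OF spd, symmetric]) simp
  next
    case 2
    then show ?thesis using sym_pos_def_inner_pos[OF spd nz]
      by (simp only: 2 mat_power_inner[OF spd, symmetric] mat_power_Suc_mult_vec)
  qed
qed

text \<open>The point of these indices: the first two add up to \<open>m\<close>, the second and
  third to \<open>Suc m\<close>. These are the exponents of \<open>A\<close> in the numerator and
  denominator of the step size.\<close>

lemma half_integer_floors:
  fixes l :: real
  assumes "l = real m / 2"
  shows "nat \<lfloor>l\<rfloor> = m div 2" "nat \<lfloor>l + 1/2\<rfloor> = Suc m div 2" "nat \<lfloor>l + 1\<rfloor> = Suc (m div 2)"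
    "nat \<lfloor>2 * l\<rfloor> = m" "l \<in> \<int> \<longleftrightarrow> even m"
proof -
  have *: "\<lfloor>real a / 2\<rfloor> = int (a div 2)" for a
    using floor_divide_of_nat_eq[of a 2, where 'a = real] by simp
  show "nat \<lfloor>l\<rfloor> = m div 2" "nat \<lfloor>l + 1\<rfloor> = Suc (m div 2)" using *[of m] by (auto simp: assms)
  have "l + 1/2 = real (Suc m) / 2" by (simp add: assms field_simps)
  then show "nat \<lfloor>l + 1/2\<rfloor> = Suc m div 2" by (simp only: * nat_int)
  show "nat \<lfloor>2 * l\<rfloor> = m" by (simp add: assms)
  show "l \<in> \<int> \<longleftrightarrow> even m"
  proof
    assume "l \<in> \<int>"
    then obtain z where "l = of_int z" by (auto elim: Ints_cases)
    then have "real m = 2 * of_int z" using assms by simp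
    then have "int m = 2 * z" by linarith
    then show "even m" by presburger
  qed (auto simp: assms)
qed

lemma mat_half_power_inner:
  fixes A :: "real^'n^'n" and g :: "real^'n"
  assumes spd: "sym_pos_def A" and l: "l = real m / 2"
  defines "y \<equiv> mat_half_power A l *v g"
  shows "y \<bullet> y = g \<bullet> (mat_power A m *v g)" "y \<bullet> (A *v y) = g \<bullet> (mat_power A (Suc m) *v g)"
proof -
  have "y \<bullet> y = g \<bullet> (mat_power A m *v g) \<and> y \<bullet> (A *v y) = g \<bullet> (mat_power A (Suc m) *v g)"
  proof (cases "even m")
    case True
    then have y: "y = mat_power A (m div 2) *v g"
      by (simp add: y_def mat_half_power_def half_integer_floors[OF l])
    have "m div 2 + m div 2 = m" "m div 2 + Suc (m div 2) = Suc m" using True by auto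
    then show ?thesis
      by (simp only: y mat_power_inner[OF spd] mat_power_Suc_mult_vec[symmetric] simp_thms)
  next
    case False
    \<comment> \<open>For odd \<open>m\<close> everything is rewritten in powers of the root, with
      \<open>A\<close> itself counting as \<open>S^2\<close>; self-adjointness of \<open>S\<close>
      then collects the exponents.\<close>
    define S where "S = mat_sqrt A"
    have S: "sym_pos_def S" "mat_power S 2 = A"
      using mat_sqrt[OF spd] by (auto simp: S_def numeral_2_eq_2)
    have y: "y = mat_power S m *v g"
      using False by (simp add: y_def S_def mat_half_power_def half_integer_floors[OF l])
    have A: "mat_power A j = mat_power S (2 * j)" for j
      by (simp add: mat_power_mat_power flip: S(2))
    have "A *v y = mat_power S (2 + m) *v g"
      by (simp only: y S(2)[symmetric] mat_power_mult_vec_add)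
    moreover have "m + m = 2 * m" "m + (2 + m) = 2 * Suc m" by auto
    ultimately show ?thesis
      by (simp only: y A mat_power_inner[OF S(1)] simp_thms)
  qed
  then show "y \<bullet> y = g \<bullet> (mat_power A m *v g)" "y \<bullet> (A *v y) = g \<bullet> (mat_power A (Suc m) *v g)"
    by auto
qed

section \<open>The gradient of the quadratic objective and the step size in integer powers\<close>

lemma gradient_eqI: "GDERIV f x :> D \<Longrightarrow> gradient f x = D"
  unfolding gradient_def gderiv_def
  by (rule the_equality, assumption)
     (metis (mono_tags) has_derivative_unique vector_eq_ldot)

text \<open>The product rule yields \<open>x \<bullet> (A *v h)\<close> and
  \<open>h \<bullet> (A *v x)\<close>; symmetry makes them equal and cancels the factor 1/2.\<close>

lemma gradient_quad_obj:
  fixes A :: "real^'n^'n"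
  assumes "transpose A = A"
  shows "gradient (quad_obj A b) x = A *v x - b"
proof (rule gradient_eqI)
  have [derivative_intros]: "((*v) A has_derivative (*v) A) F" for F
    by (intro bounded_linear_imp_has_derivative matrix_vector_mul_bounded_linear)
  show "GDERIV (quad_obj A b) x :> A *v x - b"
    unfolding gderiv_def quad_obj_def
    by (auto intro!: derivative_eq_intros ext simp: inner_diff_right)
       (metis assms inner_commute symmetric_matrix_iff)
qed

text \<open>Removes the gradient and the half-integer power, leaving a form with which both the
  scheme and the program can be compared directly.\<close>

lemma mgd_step_size_eq:
  fixes A :: "real^'n^'n" and b x :: "real^'n"
  assumes spd: "sym_pos_def A" and l: "l = real m / 2"
  defines "g \<equiv> A *v x - b"
  shows "mgd_step_size A b l x =
    (if g = 0 then 0 else (g \<bullet> (mat_power A m *v g)) / (g \<bullet> (mat_power A (Suc m) *v g)))"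
  using spd mat_half_power_inner[OF spd l]
  by (simp add: mgd_step_size_def Let_def gradient_quad_obj sym_pos_def_def g_def)

section \<open>Execution of the programs\<close>

lemma run_append: "run A (p @ q) M = run A q (run A p M)"
  by (simp add: run_def)

lemma run_Cons: "run A (i # p) M = run A p (exec A i M)"
  by (simp add: run_def)

lemma run_Nil: "run A [] M = M"
  by (simp add: run_def)

lemma run_krylov:
  "run A (map (\<lambda>j. MatVec (VReg (Suc j)) (VReg j)) [0..<n]) (V, S) =
    (\<lambda>r. case r of VReg j \<Rightarrow> if j \<le> n then mat_power A j *v V (VReg 0) else V r | _ \<Rightarrow> V r, S)"
proof (induction n)
  case 0
  show ?case by (auto simp: run_Nil fun_eq_iff split: vreg.split)
next
  case (Suc n)
  show ?case
    by (simp add: run_append run_Cons run_Nil Suc.IH)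
       (auto simp: fun_eq_iff le_Suc_eq matrix_vector_mul_assoc split: vreg.split)
qed

text \<open>The sequential updates act like a simultaneous one: instruction \<open>j\<close> reads
  register \<open>j + 1\<close>, which none of the earlier instructions has written.\<close>

lemma run_axpys:
  "run A (map (\<lambda>j. Axpy (VReg j) c (VReg (Suc j))) [0..<n]) (V, S) =
    (\<lambda>r. case r of VReg j \<Rightarrow> if j < n then V r + S c *\<^sub>R V (VReg (Suc j)) else V r | _ \<Rightarrow> V r, S)"
proof (induction n)
  case 0
  show ?case by (auto simp: run_Nil fun_eq_iff split: vreg.split)
next
  case (Suc n)
  show ?case
    by (simp add: run_append run_Cons run_Nil Suc.IH)
       (auto simp: fun_eq_iff less_Suc_eq split: vreg.split)
qed

lemma run_init:
  fixes A :: "real^'n^'n"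
  assumes "V' = fst (run A (init_prog l) (V, S))" and [simp]: "V XReg = x" "V BReg = b"
  shows "V' XReg = x" "V' BReg = b"
    "\<And>j. j \<le> nat \<lfloor>l\<rfloor> + 1 \<Longrightarrow> V' (VReg j) = mat_power A j *v (A *v x - b)"
  by (simp_all add: assms(1) init_prog_def krylov_prog_def residual_prog_def
      run_append run_Cons run_Nil run_krylov del: upt_Suc)

text \<open>The new residual is \<open>g - (\<omega> * a) *\<^sub>R (A *v g)\<close>; applying
  \<open>A^j\<close> turns this into an axpy of registers \<open>j\<close> and \<open>j + 1\<close>.
  The last register has no successor, hence the single product with \<open>A\<close>.\<close>

lemma run_iter:
  fixes A :: "real^'n^'n" and b x :: "real^'n"
  assumes spd: "sym_pos_def A" and l: "l = real m / 2"
    and V': "V' = fst (run A (iter_prog l \<omega>) (V, S))" and X: "V XReg = x" and B: "V BReg = b"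
    and V: "\<And>j. j \<le> nat \<lfloor>l\<rfloor> + 1 \<Longrightarrow> V (VReg j) = mat_power A j *v (A *v x - b)"
  defines "x' \<equiv> x - (\<omega> * mgd_step_size A b l x) *\<^sub>R (A *v x - b)"
  shows "V' XReg = x'" "V' BReg = b"
    "\<And>j. j \<le> nat \<lfloor>l\<rfloor> + 1 \<Longrightarrow> V' (VReg j) = mat_power A j *v (A *v x' - b)"
proof -
  define h g where "h = m div 2" and "g = A *v x - b"
  define a where "a = mgd_step_size A b l x"
  note fl = half_integer_floors[OF l, folded h_def]
  have Vj: "V (VReg j) = mat_power A j *v g" if "j \<le> Suc h" for j
    using V[of j] that by (simp add: fl g_def)
  have le: "h \<le> Suc h" "Suc m div 2 \<le> Suc h" "Suc h \<le> Suc h" by (auto simp: h_def)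
  have sums: "h + Suc m div 2 = m" "Suc m div 2 + Suc h = Suc m" unfolding h_def by linarith+
  have num: "V (VReg h) \<bullet> V (VReg (Suc m div 2)) = g \<bullet> (mat_power A m *v g)"
    by (simp only: Vj le mat_power_inner[OF spd] sums)
  have den: "V (VReg (Suc m div 2)) \<bullet> V (VReg (Suc h)) = g \<bullet> (mat_power A (Suc m) *v g)"
    by (simp only: Vj le mat_power_inner[OF spd] sums)
  \<comment> \<open>The machine tests the denominator for zero, the method tests the gradient.
    Positivity of the powers of \<open>A\<close> makes the two tests agree.\<close>
  have a: "a = (if g \<bullet> (mat_power A (Suc m) *v g) = 0 then 0
      else (g \<bullet> (mat_power A m *v g)) / (g \<bullet> (mat_power A (Suc m) *v g)))"
    using mat_power_inner_pos[OF spd, of g "Suc m"] mgd_step_size_eq[OF spd l, of b x]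
    unfolding a_def g_def[symmetric] by (cases "g = 0") auto
  have g': "A *v x' - b = g - (\<omega> * a) *\<^sub>R (A *v g)"
    by (simp add: x'_def a_def g_def matrix_vector_mult_diff_distrib matrix_vector_mult_scaleR)
  have upd: "mat_power A j *v (A *v x' - b)
      = mat_power A j *v g - (\<omega> * a) *\<^sub>R (mat_power A (Suc j) *v g)" for j
    by (simp add: g' matrix_vector_mult_diff_distrib matrix_vector_mult_scaleR
        mat_power_Suc_mult_vec' del: mat_power.simps)
  \<comment> \<open>The right-hand side mentions only old contents: the final product acts on the
    updated register \<open>h\<close>, written out here, while register \<open>Suc h\<close> still
    enters with its old value.\<close>
  have V'_eq: "V' = (\<lambda>r. case r of XReg \<Rightarrow> V XReg - (\<omega> * a) *\<^sub>R V (VReg 0) | BReg \<Rightarrow> V BReg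
      | VReg j \<Rightarrow> if j \<le> h then V r - (\<omega> * a) *\<^sub>R V (VReg (Suc j))
          else if j = Suc h then A *v (V (VReg h) - (\<omega> * a) *\<^sub>R V (VReg (Suc h))) else V r)"
    by (rule ext, simp only: V' iter_prog_def fl)
       (auto simp: run_append run_Cons run_Nil run_axpys num den a
         simp del: mat_power.simps upt_Suc split: vreg.split)
  have "V' = (\<lambda>r. case r of XReg \<Rightarrow> x' | BReg \<Rightarrow> b
      | VReg j \<Rightarrow> if j \<le> Suc h then mat_power A j *v (A *v x' - b) else V r)"
  proof
    fix r
    show "V' r = (case r of XReg \<Rightarrow> x' | BReg \<Rightarrow> b
        | VReg j \<Rightarrow> if j \<le> Suc h then mat_power A j *v (A *v x' - b) else V r)"
    proof (cases r)
      case XReg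
      then show ?thesis using Vj[of 0] by (simp add: V'_eq X x'_def a_def g_def)
    next
      case (VReg j)
      consider "j \<le> h" | "j = Suc h" | "j > Suc h" by linarith
      then show ?thesis
      proof cases
        case 1
        then show ?thesis by (simp add: VReg V'_eq Vj upd del: mat_power.simps)
      next
        case 2
        have "V' r = A *v (mat_power A h *v (A *v x' - b))"
          by (simp add: 2 VReg V'_eq Vj upd del: mat_power.simps)
        then show ?thesis by (simp add: 2 VReg matrix_vector_mul_assoc)
      qed (simp add: VReg V'_eq)
    qed (simp add: V'_eq B)
  qed
  then show "V' XReg = x'" "V' BReg = b"
    "\<And>j. j \<le> nat \<lfloor>l\<rfloor> + 1 \<Longrightarrow> V' (VReg j) = mat_power A j *v (A *v x' - b)"
    by (auto simp: fl)
qed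

text \<open>\<open>replicate\<close> unfolds at the front, whereas the induction over iterations
  needs the latest one at the end.\<close>

lemma full_prog_Suc: "full_prog l \<omega> (Suc k) = full_prog l \<omega> k @ iter_prog l \<omega>"
proof -
  have "p @ concat (replicate k p) = concat (replicate k p) @ p" for p :: "instr list"
    by (induction k) auto
  then show ?thesis by (simp add: full_prog_def)
qed

lemma run_full:
  fixes A :: "real^'n^'n" and V :: "vreg \<Rightarrow> real^'n" and S :: "nat \<Rightarrow> real" and \<omega> :: real
  assumes spd: "sym_pos_def A" and l: "l = real m / 2" and X: "V XReg = x0" and B: "V BReg = b"
  defines "V' k \<equiv> fst (run A (full_prog l \<omega> k) (V, S))"
  shows "V' k XReg = rlmgd A b l \<omega> x0 k \<and> V' k BReg = b \<and>
    (\<forall>j \<le> nat \<lfloor>l\<rfloor> + 1. V' k (VReg j) = mat_power A j *v (A *v rlmgd A b l \<omega> x0 k - b))"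
proof (induction k)
  case 0
  have "V' 0 = fst (run A (init_prog l) (V, S))" by (simp add: V'_def full_prog_def)
  from run_init[OF this X B] show ?case by auto
next
  case (Suc k)
  \<comment> \<open>Scalar contents left by earlier iterations are harmless: \<open>run_iter\<close>
    holds for every scalar memory.\<close>
  define S' where "S' = snd (run A (full_prog l \<omega> k) (V, S))"
  have "V' (Suc k) = fst (run A (iter_prog l \<omega>) (V' k, S'))"
    by (simp add: V'_def S'_def full_prog_Suc run_append)
  note step = run_iter[OF spd l this, of "rlmgd A b l \<omega> x0 k" b]
  have "rlmgd A b l \<omega> x0 (Suc k) = rlmgd A b l \<omega> x0 k
      - (\<omega> * mgd_step_size A b l (rlmgd A b l \<omega> x0 k)) *\<^sub>R (A *v rlmgd A b l \<omega> x0 k - b)"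
    using spd by (simp add: gradient_quad_obj sym_pos_def_def)
  with Suc.IH step show ?case by (simp del: rlmgd.simps)
qed

section \<open>Operation counts and storage\<close>

lemma matvec_count_append: "matvec_count (p @ q) = matvec_count p + matvec_count q"
  by (simp add: matvec_count_def)

lemma matvec_count_residual_prog: "matvec_count residual_prog = 1"
  by (simp add: matvec_count_def residual_prog_def)

lemma matvec_count_krylov_prog: "matvec_count (krylov_prog l) = nat \<lfloor>l\<rfloor> + 1"
  by (simp add: matvec_count_def krylov_prog_def filter_map o_def del: upt_Suc)

lemma matvec_count_init_prog: "matvec_count (init_prog l) = nat \<lfloor>l\<rfloor> + 2"
  by (simp add: init_prog_def matvec_count_append matvec_count_residual_prog matvec_count_krylov_prog)

lemma matvec_count_iter_prog: "matvec_count (iter_prog l \<omega>) = 1"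
  by (simp add: matvec_count_def iter_prog_def filter_map o_def del: upt_Suc)

lemma matvec_count_full_prog: "matvec_count (full_prog l \<omega> k) = nat \<lfloor>l\<rfloor> + 2 + k"
proof (induction k)
  case 0
  show ?case using matvec_count_init_prog[of l] by (simp add: full_prog_def)
next
  case (Suc k)
  then show ?case by (simp add: full_prog_Suc matvec_count_append matvec_count_iter_prog)
qed

lemma vregs_append: "vregs (p @ q) = vregs p \<union> vregs q"
  by (simp add: vregs_def)

lemma vregs_init_prog: "vregs (init_prog l) = {XReg, BReg} \<union> VReg ` {0..nat \<lfloor>l\<rfloor> + 1}"
proof -
  have "vregs (krylov_prog l) = (\<Union>j\<in>{0..nat \<lfloor>l\<rfloor>}. {VReg (Suc j), VReg j})"
    by (simp add: vregs_def krylov_prog_def atLeastLessThanSuc_atLeastAtMost del: upt_Suc)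
  also have "\<dots> = VReg ` {0..nat \<lfloor>l\<rfloor> + 1}"
  proof -
    have "{0..n + 1} = (\<Union>j\<in>{0..n}. {Suc j, j})" for n :: nat
      by (force simp: le_Suc_eq)
    then show ?thesis by auto
  qed
  finally have "vregs (krylov_prog l) = VReg ` {0..nat \<lfloor>l\<rfloor> + 1}" .
  then show ?thesis
    unfolding init_prog_def vregs_append by (auto simp: vregs_def residual_prog_def)
qed

lemma vregs_iter_prog:
  assumes "l \<ge> 0"
  shows "vregs (iter_prog l \<omega>) \<subseteq> {XReg} \<union> VReg ` {0..nat \<lfloor>l\<rfloor> + 1}"
proof -
  have "nat \<lfloor>l + 1/2\<rfloor> \<le> nat \<lfloor>l\<rfloor> + 1" "nat \<lfloor>l + 1\<rfloor> = nat \<lfloor>l\<rfloor> + 1" using assms by linarith+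
  then show ?thesis by (auto simp: vregs_def iter_prog_def simp del: upt_Suc)
qed

text \<open>Initialization already touches every register and the iterations only reuse them, so the
  storage does not grow with \<open>k\<close>.\<close>

lemma vregs_full_prog:
  assumes "l \<ge> 0"
  shows "vregs (full_prog l \<omega> k) = {XReg, BReg} \<union> VReg ` {0..nat \<lfloor>l\<rfloor> + 1}"
proof (induction k)
  case 0
  show ?case using vregs_init_prog[of l] by (simp add: full_prog_def)
next
  case (Suc k)
  then show ?case
    unfolding full_prog_Suc vregs_append using vregs_iter_prog[OF assms, of \<omega>] by blast
qed

section \<open>Agreement of the scheme, the method and the program\<close>

theorem mainTheorem4:
  fixes A :: "real^'n^'n" and b x0 :: "real^'n" and l \<omega> :: real
    and x :: "nat \<Rightarrow> real^'n" and v :: "nat \<Rightarrow> nat \<Rightarrow> real^'n" and \<alpha> :: "nat \<Rightarrow> real"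
  assumes spd: "sym_pos_def A"
    and l: "l \<in> {real m / 2 | m :: nat. True}"
    and omega: "\<omega> \<in> {0<..<2}"
    and x_0: "x 0 = x0"
    and v_0_0: "v 0 0 = A *v x0 - b"
    and v_0: "\<And>j. j \<in> {1..nat \<lfloor>l\<rfloor> + 1} \<Longrightarrow> v 0 j = A *v v 0 (j - 1)"
    and alpha: "\<And>k. \<alpha> k =
          (if v k 0 = 0 then 0
           else (v k (nat \<lfloor>l\<rfloor>) \<bullet> v k (nat \<lfloor>l + 1/2\<rfloor>))
              / (v k (nat \<lfloor>l + 1/2\<rfloor>) \<bullet> v k (nat \<lfloor>l + 1\<rfloor>)))"
    and x_Suc: "\<And>k. x (Suc k) = x k - (\<omega> * \<alpha> k) *\<^sub>R v k 0"
    and v_Suc: "\<And>k j. j \<in> {0..nat \<lfloor>l\<rfloor>} \<Longrightarrow>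
          v (Suc k) j = v k j - (\<omega> * \<alpha> k) *\<^sub>R v k (j + 1)"
    and v_Suc_last: "\<And>k. v (Suc k) (nat \<lfloor>l\<rfloor> + 1) = A *v v (Suc k) (nat \<lfloor>l\<rfloor>)"
  shows
    "(\<forall>k. x k = rlmgd A b l \<omega> x0 k
        \<and> gradient (quad_obj A b) (x k) = A *v x k - b
        \<and> (\<forall>j \<in> {0..nat \<lfloor>l\<rfloor> + 1}. v k j = mat_power A j *v (A *v x k - b))
        \<and> \<alpha> k = mgd_step_size A b l (x k))
   \<and> (\<forall>k V S. V XReg = x0 \<and> V BReg = b \<longrightarrow>
        (let V' = fst (run A (full_prog l \<omega> k) (V, S))
         in V' XReg = rlmgd A b l \<omega> x0 k \<and> V' BReg = b
            \<and> (\<forall>j \<in> {0..nat \<lfloor>l\<rfloor> + 1}. V' (VReg j) = v k j)))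
   \<and> matvec_count residual_prog = 1
   \<and> matvec_count (krylov_prog l) = nat \<lfloor>l\<rfloor> + 1
   \<and> matvec_count (init_prog l) = nat \<lfloor>l\<rfloor> + 2
   \<and> matvec_count (iter_prog l \<omega>) = 1
   \<and> (\<forall>k. matvec_count (full_prog l \<omega> k) = nat \<lfloor>l\<rfloor> + 2 + k)
   \<and> (\<forall>k. vregs (full_prog l \<omega> k) - {XReg, BReg} = VReg ` {0..nat \<lfloor>l\<rfloor> + 1})
   \<and> card (VReg ` {0..nat \<lfloor>l\<rfloor> + 1}) = nat \<lfloor>l\<rfloor> + 2"
proof -
  obtain m where m: "l = real m / 2" using l by blast
  then have l0: "l \<ge> 0" by simp
  define h where "h = m div 2"
  note fl = half_integer_floors[OF m, folded h_def]
  have le: "h \<le> Suc h" "Suc m div 2 \<le> Suc h" "Suc h \<le> Suc h" by (auto simp: h_def)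
  have sums: "h + Suc m div 2 = m" "Suc m div 2 + Suc h = Suc m" unfolding h_def by linarith+
  have grad: "gradient (quad_obj A b) y = A *v y - b" for y
    using spd by (simp add: gradient_quad_obj sym_pos_def_def)
  \<comment> \<open>Given the invariant, the zero tests coincide because \<open>v k 0\<close> is the
    gradient, and the inner products coincide because their exponents have the same sums.\<close>
  have step: "\<alpha> k = mgd_step_size A b l (x k)"
    if v: "\<And>j. j \<le> Suc h \<Longrightarrow> v k j = mat_power A j *v (A *v x k - b)" for k
  proof -
    have "v k 0 = A *v x k - b" using v[of 0] by simp
    then show ?thesis
      unfolding alpha mgd_step_size_eq[OF spd m] fl
      by (simp only: v le mat_power_inner[OF spd] sums)
  qed
  \<comment> \<open>The recurrences are linear, so the induction carries \<open>\<alpha> k\<close>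
    along as a symbol; its value is identified afterwards through \<open>step\<close>.\<close>
  have v: "\<forall>j \<le> Suc h. v k j = mat_power A j *v (A *v x k - b)" for k
  proof (induction k)
    case 0
    have "v 0 j = mat_power A j *v (A *v x 0 - b)" if "j \<le> Suc h" for j
      using that
    proof (induction j)
      case (Suc j)
      then have "v 0 (Suc j) = A *v v 0 j" using v_0[of "Suc j"] by (simp add: fl)
      with Suc show ?case by (simp add: matrix_vector_mul_assoc)
    qed (simp add: x_0 v_0_0)
    then show ?case by blast
  next
    case (Suc k)
    have "v k 0 = A *v x k - b" using Suc[rule_format, of 0] by simp
    then have g: "A *v x (Suc k) - b = (A *v x k - b) - (\<omega> * \<alpha> k) *\<^sub>R (A *v (A *v x k - b))"
      by (simp add: x_Suc matrix_vector_mult_diff_distrib matrix_vector_mult_scaleR)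
    \<comment> \<open>Entries up to \<open>h\<close> follow from the update with the old successor;
      entry \<open>Suc h\<close> is then the product of \<open>A\<close> with the new entry
      \<open>h\<close>.\<close>
    have less: "v (Suc k) j = mat_power A j *v (A *v x (Suc k) - b)" if "j \<le> h" for j
    proof -
      have "v (Suc k) j = v k j - (\<omega> * \<alpha> k) *\<^sub>R v k (Suc j)"
        using v_Suc[of j k] that by (simp add: fl)
      then show ?thesis
        using Suc that by (simp add: g matrix_vector_mult_diff_distrib[of "mat_power A j"]
          matrix_vector_mult_scaleR mat_power_Suc_mult_vec' del: mat_power.simps)
    qed
    moreover have "v (Suc k) (Suc h) = mat_power A (Suc h) *v (A *v x (Suc k) - b)"
      using v_Suc_last[of k] less[of h] by (simp add: fl matrix_vector_mul_assoc)
    ultimately show ?case by (auto simp: le_Suc_eq)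
  qed
  have x: "x k = rlmgd A b l \<omega> x0 k" for k
  proof (induction k)
    case (Suc k)
    have "v k 0 = A *v x k - b" using v[of k] by auto
    then show ?case
      by (simp add: x_Suc grad flip: Suc) (use step v in auto)
  qed (simp add: x_0)
  have card: "card (VReg ` {0..nat \<lfloor>l\<rfloor> + 1}) = nat \<lfloor>l\<rfloor> + 2"
    by (subst card_image) (auto simp: inj_on_def)
  have "\<forall>k. x k = rlmgd A b l \<omega> x0 k
        \<and> gradient (quad_obj A b) (x k) = A *v x k - b
        \<and> (\<forall>j \<in> {0..nat \<lfloor>l\<rfloor> + 1}. v k j = mat_power A j *v (A *v x k - b))
        \<and> \<alpha> k = mgd_step_size A b l (x k)"
    using x grad v step by (simp add: fl)
  moreover have "\<forall>k V S. V XReg = x0 \<and> V BReg = b \<longrightarrow>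
        (let V' = fst (run A (full_prog l \<omega> k) (V, S))
         in V' XReg = rlmgd A b l \<omega> x0 k \<and> V' BReg = b
            \<and> (\<forall>j \<in> {0..nat \<lfloor>l\<rfloor> + 1}. V' (VReg j) = v k j))"
    using run_full[OF spd m, of _ x0 b \<omega>] v by (simp add: Let_def fl x)
  moreover have "\<forall>k. vregs (full_prog l \<omega> k) - {XReg, BReg} = VReg ` {0..nat \<lfloor>l\<rfloor> + 1}"
    using vregs_full_prog[OF l0, of \<omega>] by auto
  ultimately show ?thesis
    using matvec_count_residual_prog matvec_count_krylov_prog[of l] matvec_count_init_prog[of l]
      matvec_count_iter_prog[of l \<omega>] matvec_count_full_prog[of l \<omega>] card by blast
qed

end
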